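(* Let $\mathfrak{sgal}(3)^*$ be the dual of the (centrally extended) Lie algebra of the special Galilei group, with elements $\mu=(j,k,p,E,m)$, where $j\in\mathbb{R}^3$ is the angular momentum, $k\in\mathbb{R}^3$ the static moment (Galilean boost), $p\in\mathbb{R}^3$ the linear momentum, $E\in\mathbb{R}$ the energy and $m>0$ the mass parameter. Let $\mathcal{O}=\{m,U,S^2\}$ be the Souriau coadjoint orbit characterized by a constant mass $m$, a constant internal energy $U=E-\frac{\|p\|^2}{2m}$, and a constant magnitude of the Souriau spin vector $S=j-\frac1m(k\times p)$. Then there exists on $\mathcal{O}$ a Lagrangian foliation $$\mathcal{F}=\{(q,p):\ q\in\mathbb{R}^3,\ p\ \text{fixed}\}$$ with respect to the Kirillov–Kostant–Souriau symplectic structure $\omega=\sum_{i=1}^3\mathrm{d}q_i\wedge\mathrm{d}p_i$, where $p=(p_1,p_2,p_3)$ and $q=\left(\frac{k_1}{m},\frac{k_2}{m},\frac{k_3}{m}\right)$.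
   Context: $\mathrm{SGal}(3)$ is the group of $5\times5$ matrices $\begin{pmatrix}A&b&c\\0&1&e\\0&0&1\end{pmatrix}$ with $A\in\mathrm{SO}(3)$, $b,c\in\mathbb{R}^3$, $e\in\mathbb{R}$. The mass is the coordinate dual to the central generator $M$ of the Bargmann central extension, whose Lie algebra has generators $J_i$ (rotations), $K_i$ (boosts), $P_i$ (space translations), $H$ (time translation), $M$ (central), $i=1,2,3$, with brackets $$[J_i,J_l]=\sum_r\epsilon_{ilr}J_r,\quad [J_i,K_l]=\sum_r\epsilon_{ilr}K_r,\quad [J_i,P_l]=\sum_r\epsilon_{ilr}P_r,\quad [K_i,H]=P_i,\quad [K_i,P_l]=\delta_{il}M,$$ all other brackets of generators being zero. The coordinates on the dual are $j_i=\mu(J_i)$, $k_i=\mu(K_i)$, $p_i=\mu(P_i)$, $E=\mu(H)$, $m=\mu(M)$. The coadjoint orbit $\mathcal{O}$ is the common level set of the Casimir functions $m$, $U$ and $S^2=\|S\|^2$. The Kirillov–Kostant–Souriau form on a coadjoint orbit is $\omega_\mu(\mathrm{ad}^*_X\mu,\mathrm{ad}^*_Y\mu)=\langle\mu,[X,Y]\rangle$. A foliation is Lagrangian if its leaves are Lagrangian submanifolds for $\omega$.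
   Formalization: For S²>0 the orbit is 8-dimensional and the KKS form has an extra spin term, so the claim fails; it is proved on all of O only for S²=0, and for every S²≥0 on each subset of O with fixed spin vector S, using the restricted KKS form. *)

theory Defs
  imports "HOL-Analysis.Analysis"
begin

unbundle cross3_syntax

section \<open>Smooth submanifolds and foliations of Euclidean space\<close>

fun Ck_on :: "nat \<Rightarrow> 'a::euclidean_space set \<Rightarrow> ('a \<Rightarrow> 'b::euclidean_space) \<Rightarrow> bool" where
  "Ck_on 0 W f \<longleftrightarrow> continuous_on W f"
| "Ck_on (Suc n) W f \<longleftrightarrow>
     (\<forall>x\<in>W. f differentiable (at x)) \<and> (\<forall>v. Ck_on n W (\<lambda>x. frechet_derivative f (at x) v))"

(* Meant for open W only, since the derivatives are taken in the ambient space. *)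
definition smooth_on :: "'a::euclidean_space set \<Rightarrow> ('a \<Rightarrow> 'b::euclidean_space) \<Rightarrow> bool" where
  "smooth_on W f \<longleftrightarrow> (\<forall>n. Ck_on n W f)"

definition smooth_diffeo ::
    "'a::euclidean_space set \<Rightarrow> 'a set \<Rightarrow> ('a \<Rightarrow> 'a) \<Rightarrow> bool" where
  "smooth_diffeo W W' \<Phi> \<longleftrightarrow> open W \<and> open W' \<and> smooth_on W \<Phi> \<and>
     (\<exists>\<Psi>. homeomorphism W W' \<Phi> \<Psi> \<and> smooth_on W' \<Psi>)"

(* Embedded n-dimensional submanifold, by slice charts of the ambient space. *)
definition submanifold :: "nat \<Rightarrow> 'a::euclidean_space set \<Rightarrow> bool" where
  "submanifold n M \<longleftrightarrow>
     (\<forall>x\<in>M. \<exists>W W' \<Phi> V. x \<in> W \<and> smooth_diffeo W W' \<Phi> \<and>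
        subspace V \<and> dim V = n \<and> \<Phi> ` (M \<inter> W) = V \<inter> W')"

definition tangent_space :: "'a::euclidean_space set \<Rightarrow> 'a \<Rightarrow> 'a set" where
  "tangent_space M x =
     {v. \<exists>\<gamma> e. e > 0 \<and> \<gamma> 0 = x \<and> (\<forall>t. \<bar>t\<bar> < e \<longrightarrow> \<gamma> t \<in> M) \<and>
         (\<gamma> has_vector_derivative v) (at (0::real))}"

(* A d-dimensional foliation of the n-dimensional submanifold M, as its set of leaves: a partition
   of M into path-connected sets such that in suitable slice charts, mapping M onto the subspace V,
   the components of each leaf are the slices of V parallel to the d-dimensional subspace V0. *)
definition foliation :: "nat \<Rightarrow> nat \<Rightarrow> 'a::euclidean_space set \<Rightarrow> 'a set set \<Rightarrow> bool" where
  "foliation d n M F \<longleftrightarrow> partition_on M F \<and> (\<forall>L\<in>F. path_connected L) \<and>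
     (\<forall>x\<in>M. \<exists>W W' \<Phi> V V0. x \<in> W \<and> smooth_diffeo W W' \<Phi> \<and>
        subspace V \<and> dim V = n \<and> \<Phi> ` (M \<inter> W) = V \<inter> W' \<and>
        subspace V0 \<and> V0 \<subseteq> V \<and> dim V0 = d \<and>
        (\<forall>L\<in>F. \<forall>C\<in>components (L \<inter> W). \<exists>c\<in>V. \<Phi> ` C = {y\<in>W'. y - c \<in> V0}))"

definition linear_symplectic_on ::
    "'a::real_vector set \<Rightarrow> ('a \<Rightarrow> 'a \<Rightarrow> real) \<Rightarrow> bool" where
  "linear_symplectic_on V \<omega> \<longleftrightarrow> subspace V \<and>
     (\<forall>u\<in>V. \<forall>v\<in>V. \<forall>w\<in>V. \<forall>a b. \<omega> (a *\<^sub>R u + b *\<^sub>R v) w = a * \<omega> u w + b * \<omega> v w) \<and>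
     (\<forall>u\<in>V. \<forall>v\<in>V. \<omega> v u = - \<omega> u v) \<and>
     (\<forall>u\<in>V. (\<forall>v\<in>V. \<omega> u v = 0) \<longrightarrow> u = 0)"

(* L is isotropic of half the dimension of M. *)
definition lagrangian_submanifold ::
    "nat \<Rightarrow> 'a::euclidean_space set \<Rightarrow> ('a \<Rightarrow> 'a \<Rightarrow> 'a \<Rightarrow> real) \<Rightarrow> 'a set \<Rightarrow> bool" where
  "lagrangian_submanifold n M \<omega> L \<longleftrightarrow> L \<subseteq> M \<and> submanifold (2 * n) M \<and> submanifold n L \<and>
     (\<forall>x\<in>L. \<forall>u\<in>tangent_space L x. \<forall>v\<in>tangent_space L x. \<omega> x u v = 0)"

definition lagrangian_foliation ::
    "'a::euclidean_space set \<Rightarrow> ('a \<Rightarrow> 'a \<Rightarrow> 'a \<Rightarrow> real) \<Rightarrow> 'a set set \<Rightarrow> bool" where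
  "lagrangian_foliation M \<omega> F \<longleftrightarrow>
     (\<forall>x\<in>M. linear_symplectic_on (tangent_space M x) (\<omega> x)) \<and>
     (\<exists>n. foliation n (2 * n) M F \<and> (\<forall>L\<in>F. lagrangian_submanifold n M \<omega> L))"

definition differential :: "('a::euclidean_space \<Rightarrow> real) \<Rightarrow> 'a \<Rightarrow> 'a \<Rightarrow> real" where
  "differential f x v = frechet_derivative f (at x) v"

definition wedge :: "('a \<Rightarrow> real) \<Rightarrow> ('a \<Rightarrow> real) \<Rightarrow> 'a \<Rightarrow> 'a \<Rightarrow> real" where
  "wedge \<alpha> \<beta> u v = \<alpha> u * \<beta> v - \<alpha> v * \<beta> u"

section \<open>The Bargmann extension of the Lie algebra of the special Galilei group\<close>

(* (a, b, c, h, f) stands for a.J + b.K + c.P + h H + f M.  The dual is identified with the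
   same space by means of the dual basis: (j, k, p, E, m), paired through the inner product. *)
type_synonym sgal = "(real^3) \<times> (real^3) \<times> (real^3) \<times> real \<times> real"
type_synonym sgal_dual = sgal

definition gen_J :: "3 \<Rightarrow> sgal" where "gen_J i = (axis i 1, 0, 0, 0, 0)"
definition gen_K :: "3 \<Rightarrow> sgal" where "gen_K i = (0, axis i 1, 0, 0, 0)"
definition gen_P :: "3 \<Rightarrow> sgal" where "gen_P i = (0, 0, axis i 1, 0, 0)"
definition gen_H :: sgal where "gen_H = (0, 0, 0, 1, 0)"
definition gen_M :: sgal where "gen_M = (0, 0, 0, 0, 1)"

(* The bilinear extension of the brackets of the generators, see sgal_bracket_generators. *)
fun sgal_bracket :: "sgal \<Rightarrow> sgal \<Rightarrow> sgal" where
  "sgal_bracket (a, b, c, h, f) (a', b', c', h', f') =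
     (a \<times> a', a \<times> b' + b \<times> a', a \<times> c' + c \<times> a' + h' *\<^sub>R b - h *\<^sub>R b', 0, b \<bullet> c' - b' \<bullet> c)"

definition levi_civita :: "3 \<Rightarrow> 3 \<Rightarrow> 3 \<Rightarrow> real" where
  "levi_civita i l r = (axis i 1 \<times> axis l 1) $ r"

lemma levi_civita_simps:
  "levi_civita 1 2 3 = 1" "levi_civita 2 3 1 = 1" "levi_civita 3 1 2 = 1"
  "levi_civita l i r = - levi_civita i l r" "levi_civita i r l = - levi_civita i l r"
proof -
  show "levi_civita 1 2 3 = 1" "levi_civita 2 3 1 = 1" "levi_civita 3 1 2 = 1"
    by (simp_all add: levi_civita_def cross3_def axis_def)
  have "\<forall>i l r. levi_civita l i r = - levi_civita i l r \<and> levi_civita i r l = - levi_civita i l r"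
    unfolding forall_3 by (simp add: levi_civita_def cross3_def axis_def)
  then show "levi_civita l i r = - levi_civita i l r" "levi_civita i r l = - levi_civita i l r"
    by blast+
qed

lemma sgal_bracket_bilinear: "bilinear sgal_bracket"
proof -
  have "linear (sgal_bracket X)" for X
    by (cases X, rule linearI)
      (auto simp: cross_add_right cross_mult_right algebra_simps inner_add_left inner_add_right)
  moreover have "linear (\<lambda>X. sgal_bracket X Y)" for Y
    by (cases Y, rule linearI)
      (auto simp: cross_add_left cross_mult_left algebra_simps inner_add_left inner_add_right)
  ultimately show ?thesis unfolding bilinear_def by blast
qed

lemma sgal_bracket_antisym: "sgal_bracket Y X = - sgal_bracket X Y"
  by (cases X; cases Y)
    (simp add: vec_eq_iff forall_3 cross3_def algebra_simps)

lemma sgal_bracket_generators: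
  "sgal_bracket (gen_J i) (gen_J l) = (\<Sum>r\<in>UNIV. levi_civita i l r *\<^sub>R gen_J r)"
  "sgal_bracket (gen_J i) (gen_K l) = (\<Sum>r\<in>UNIV. levi_civita i l r *\<^sub>R gen_K r)"
  "sgal_bracket (gen_J i) (gen_P l) = (\<Sum>r\<in>UNIV. levi_civita i l r *\<^sub>R gen_P r)"
  "sgal_bracket (gen_K i) gen_H = gen_P i"
  "sgal_bracket (gen_K i) (gen_P l) = (if i = l then gen_M else 0)"
  "sgal_bracket (gen_J i) gen_H = 0"
  "sgal_bracket (gen_K i) (gen_K l) = 0"
  "sgal_bracket (gen_P i) (gen_P l) = 0"
  "sgal_bracket (gen_P i) gen_H = 0"
  "sgal_bracket gen_M X = 0"
proof -
  have *: "(axis i 1 \<times> axis l 1 :: real^3) = (\<Sum>r\<in>UNIV. levi_civita i l r *\<^sub>R axis r 1)"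
    using basis_expansion[of "axis i 1 \<times> axis l 1"]
    by (simp only: levi_civita_def scalar_mult_eq_scaleR)
  show "sgal_bracket (gen_J i) (gen_J l) = (\<Sum>r\<in>UNIV. levi_civita i l r *\<^sub>R gen_J r)"
    "sgal_bracket (gen_J i) (gen_K l) = (\<Sum>r\<in>UNIV. levi_civita i l r *\<^sub>R gen_K r)"
    "sgal_bracket (gen_J i) (gen_P l) = (\<Sum>r\<in>UNIV. levi_civita i l r *\<^sub>R gen_P r)"
    by (simp_all add: gen_J_def gen_K_def gen_P_def * sum_3)
  show "sgal_bracket (gen_K i) (gen_P l) = (if i = l then gen_M else 0)"
    by (simp add: gen_K_def gen_P_def gen_M_def inner_axis_axis zero_prod_def)
  show "sgal_bracket gen_M X = 0"
    by (cases X) (simp add: gen_M_def zero_prod_def)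
qed (simp_all add: gen_J_def gen_K_def gen_P_def gen_H_def zero_prod_def)

section \<open>The Souriau orbits and their Kirillov--Kostant--Souriau form\<close>

(* The sign convention for ad* does not affect kks. *)
definition coad :: "sgal \<Rightarrow> sgal_dual \<Rightarrow> sgal_dual" where
  "coad X \<mu> = - adjoint (sgal_bracket X) \<mu>"

definition kks :: "sgal_dual \<Rightarrow> sgal_dual \<Rightarrow> sgal_dual \<Rightarrow> real" where
  "kks \<mu> u v = (THE r. \<exists>X Y. u = coad X \<mu> \<and> v = coad Y \<mu> \<and> r = \<mu> \<bullet> sgal_bracket X Y)"

lemma coad_inner: "coad X \<mu> \<bullet> Y = - (\<mu> \<bullet> sgal_bracket X Y)"
proof -
  have "linear (sgal_bracket X)" using sgal_bracket_bilinear unfolding bilinear_def by blast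
  then show ?thesis by (simp add: coad_def adjoint_works inner_commute)
qed

lemma kks_coad: "kks \<mu> (coad X \<mu>) (coad Y \<mu>) = \<mu> \<bullet> sgal_bracket X Y"
proof -
  have "\<mu> \<bullet> sgal_bracket X' Y' = \<mu> \<bullet> sgal_bracket X Y"
    if "coad X \<mu> = coad X' \<mu>" "coad Y \<mu> = coad Y' \<mu>" for X' Y'
  proof -
    have "\<mu> \<bullet> sgal_bracket X' Y' = \<mu> \<bullet> sgal_bracket X Y'"
      using that(1) coad_inner[of X \<mu> Y'] coad_inner[of X' \<mu> Y'] by simp
    also have "\<dots> = coad Y' \<mu> \<bullet> X"
      by (simp add: coad_inner sgal_bracket_antisym[of X Y'])
    also have "\<dots> = \<mu> \<bullet> sgal_bracket X Y"
      using that(2) coad_inner[of Y \<mu> X] by (simp add: sgal_bracket_antisym[of X Y])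
    finally show ?thesis .
  qed
  then show ?thesis unfolding kks_def by (intro the_equality) blast+
qed

fun angular_momentum :: "sgal_dual \<Rightarrow> real^3" where "angular_momentum (j, k, p, E, m) = j"
fun static_moment :: "sgal_dual \<Rightarrow> real^3" where "static_moment (j, k, p, E, m) = k"
fun momentum :: "sgal_dual \<Rightarrow> real^3" where "momentum (j, k, p, E, m) = p"
fun energy :: "sgal_dual \<Rightarrow> real" where "energy (j, k, p, E, m) = E"
fun mass :: "sgal_dual \<Rightarrow> real" where "mass (j, k, p, E, m) = m"

definition internal_energy :: "sgal_dual \<Rightarrow> real" where
  "internal_energy \<mu> = energy \<mu> - (norm (momentum \<mu>))\<^sup>2 / (2 * mass \<mu>)"

definition spin :: "sgal_dual \<Rightarrow> real^3" where
  "spin \<mu> = angular_momentum \<mu> - (1 / mass \<mu>) *\<^sub>R (static_moment \<mu> \<times> momentum \<mu>)"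

definition position :: "sgal_dual \<Rightarrow> real^3" where
  "position \<mu> = (1 / mass \<mu>) *\<^sub>R static_moment \<mu>"

definition souriau_orbit :: "real \<Rightarrow> real \<Rightarrow> real \<Rightarrow> sgal_dual set" where
  "souriau_orbit m U S2 = {\<mu>. mass \<mu> = m \<and> internal_energy \<mu> = U \<and> (norm (spin \<mu>))\<^sup>2 = S2}"

(* The points of the orbit with a prescribed spin vector; the whole orbit if S0 = 0. *)
definition spin_sheet :: "real \<Rightarrow> real \<Rightarrow> real^3 \<Rightarrow> sgal_dual set" where
  "spin_sheet m U S0 = {\<mu> \<in> souriau_orbit m U ((norm S0)\<^sup>2). spin \<mu> = S0}"

definition canonical_form :: "sgal_dual \<Rightarrow> sgal_dual \<Rightarrow> sgal_dual \<Rightarrow> real" where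
  "canonical_form \<mu> u v =
     (\<Sum>i\<in>UNIV. wedge (differential (\<lambda>\<nu>. position \<nu> $ i) \<mu>)
                      (differential (\<lambda>\<nu>. momentum \<nu> $ i) \<mu>) u v)"

(* If the spin does not vanish, kks has an additional term along the spin sphere, and the orbit has
   dimension 8 rather than 6. *)
lemma kks_neq_canonical_form:
  assumes "m > 0" "S2 > 0"
  shows "\<exists>\<mu>\<in>souriau_orbit m U S2. \<exists>u\<in>tangent_space (souriau_orbit m U S2) \<mu>.
    \<exists>v\<in>tangent_space (souriau_orbit m U S2) \<mu>. kks \<mu> u v \<noteq> canonical_form \<mu> u v"
proof -
  define s where "s = sqrt S2"
  have s: "s > 0" "s\<^sup>2 = S2" using assms by (auto simp: s_def)
  let ?e = "\<lambda>i::3. axis i (1::real) :: real^3"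
  define \<mu> :: sgal where "\<mu> = (s *\<^sub>R ?e 3, 0, 0, U, m)"
  define c where "c i t = (cos t *\<^sub>R (s *\<^sub>R ?e 3) + sin t *\<^sub>R (s *\<^sub>R ?e i), 0::real^3, 0::real^3, U, m)"
    for i :: 3 and t :: real
  have c: "c i t \<in> souriau_orbit m U S2" if "i \<noteq> 3" for i t
  proof -
    have "(norm (cos t *\<^sub>R (s *\<^sub>R ?e 3) + sin t *\<^sub>R (s *\<^sub>R ?e i)))\<^sup>2
        = s\<^sup>2 * ((sin t)\<^sup>2 + (cos t)\<^sup>2)"
      using that unfolding power2_norm_eq_inner
      by (simp add: inner_add_left inner_add_right inner_axis_axis power2_eq_square
          algebra_simps del: sin_cos_squared_add sin_cos_squared_add2 sin_cos_squared_add3)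
    then show ?thesis
      using s by (simp add: c_def souriau_orbit_def internal_energy_def spin_def)
  qed
  have tan: "(s *\<^sub>R ?e i, 0, 0, 0, 0) \<in> tangent_space (souriau_orbit m U S2) \<mu>" if "i \<noteq> 3" for i
  proof -
    have "(c i has_vector_derivative (s *\<^sub>R ?e i, 0, 0, 0, 0)) (at 0)"
      unfolding c_def
      by (auto intro!: derivative_eq_intros has_vector_derivative_Pair simp flip: zero_prod_def)
    moreover have "c i 0 = \<mu>" by (simp add: c_def \<mu>_def)
    ultimately show ?thesis
      unfolding tangent_space_def using c[OF that] by (auto intro!: exI[of _ "c i"] exI[of _ 1])
  qed
  have X: "coad X \<mu> = v" if "\<And>Y. - (\<mu> \<bullet> sgal_bracket X Y) = v \<bullet> Y" for X v
    by (rule vector_eq_rdot[THEN iffD1]) (simp only: coad_inner that simp_thms)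
  let ?u = "(s *\<^sub>R ?e 1, 0, 0, 0, 0) :: sgal" and ?v = "(s *\<^sub>R ?e 2, 0, 0, 0, 0) :: sgal"
  have T: "x \<bullet> (y \<times> z) = (x \<times> y) \<bullet> z" for x y z :: "real^3"
    using cross_triple[of x y z] by (simp add: inner_commute)
  have u: "coad (?e 2, 0, 0, 0, 0) \<mu> = ?u"
    by (rule X) (auto simp: \<mu>_def T cross_mult_left cross_basis)
  have v: "coad (- ?e 1, 0, 0, 0, 0) \<mu> = ?v"
    by (rule X) (auto simp: \<mu>_def T cross_mult_left cross_minus_right cross_basis)
  have "kks \<mu> ?u ?v = s"
    unfolding u[symmetric] v[symmetric] kks_coad
    by (simp add: \<mu>_def cross_minus_right cross_basis inner_axis_axis)
  moreover have "canonical_form \<mu> ?u ?v = 0"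
  proof -
    have momentum_eq: "momentum \<nu> = fst (snd (snd \<nu>))" for \<nu> by (cases \<nu>) simp
    have "bounded_linear (\<lambda>\<nu>::sgal. fst (snd (snd \<nu>)) $ i)" for i
      by (intro linear_conv_bounded_linear[THEN iffD1] linearI) simp_all
    then have "((\<lambda>\<nu>. momentum \<nu> $ i) has_derivative (\<lambda>w. fst (snd (snd w)) $ i)) (at \<mu>)" for i
      unfolding momentum_eq by (rule bounded_linear_imp_has_derivative)
    then have "differential (\<lambda>\<nu>. momentum \<nu> $ i) \<mu> w = fst (snd (snd w)) $ i" for i w
      unfolding differential_def by (rule fun_cong[OF frechet_derivative_at, symmetric])
    then show ?thesis by (simp add: canonical_form_def wedge_def)
  qed
  moreover have "\<mu> \<in> souriau_orbit m U S2"
    using c[of 1 0] by (simp add: c_def \<mu>_def)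
  moreover have "?u \<in> tangent_space (souriau_orbit m U S2) \<mu>"
    "?v \<in> tangent_space (souriau_orbit m U S2) \<mu>"
    by (rule tan, simp)+
  ultimately show ?thesis
    using s(1) by (intro bexI[of _ \<mu>] bexI[of _ ?u] bexI[of _ ?v]) simp_all
qed

definition momentum_foliation :: "sgal_dual set \<Rightarrow> sgal_dual set set" where
  "momentum_foliation N = (\<lambda>p. {\<mu> \<in> N. momentum \<mu> = p}) ` UNIV"

end

theory Submission
  imports Defs
begin

text \<open>On a sheet of constant spin vector \<open>S0\<close> the angular momentum and the energy
  are functions of the static moment \<open>k\<close> and the momentum \<open>p\<close>, namely
  \<open>S0 + (k \<times> p) / m\<close> and \<open>U + p \<bullet> p / (2 * m)\<close>.  The sheet is
  thus the graph of a quadratic map over the space of all \<open>(k, p)\<close>.  Subtracting this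
  quadratic map is a polynomial diffeomorphism of the whole ambient space with polynomial inverse
  (\<open>quadratic_shear\<close>); it turns the sheet into a linear subspace of dimension 6 and the
  sets of constant \<open>p\<close> into parallel affine subspaces of dimension 3.  One global chart
  therefore yields the manifold, its tangent spaces and the foliation.

  For the symplectic forms, the infinitesimal boosts and translations leave the spin vector fixed
  and already move \<open>(k, p)\<close> in every direction: the element with boost part
  \<open>b\<close> and translation part \<open>c\<close> acts by \<open>dk = m *\<^sub>R c\<close>,
  \<open>dp = - m *\<^sub>R b\<close> (\<open>coad_boost_translation\<close>).  Hence each tangent
  vector of a sheet is a coadjoint vector of this type, and the Kirillov--Kostant--Souriau form
  is read off the only bracket that matters, the one of boosts with translations, which is the
  mass times \<open>b \<bullet> c' - b' \<bullet> c\<close>.  With \<open>q = k / m\<close> this is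
  \<open>dq \<and> dp\<close> (\<open>kks_eq_canonical_form\<close>); it is nondegenerate, and it vanishes
  where \<open>dp = 0\<close>, that is, on the leaves.

  The orbit of spin 0 consists of the single sheet \<open>S0 = 0\<close>.\<close>

section \<open>Straightening by a quadratic shear\<close>

lemma bilinear_diagonal_has_derivative:
  fixes B :: "'a::euclidean_space \<Rightarrow> 'a \<Rightarrow> 'b::euclidean_space"
  assumes "bilinear B"
  shows "((\<lambda>x. B x x) has_derivative (\<lambda>v. B x v + B v x)) (at x)"
proof -
  interpret bounded_bilinear B
    using assms bilinear_conv_bounded_bilinear by blast
  show ?thesis
    by (rule FDERIV[OF has_derivative_ident has_derivative_ident])
qed

lemma quadratic_has_derivative:
  fixes L :: "'a::euclidean_space \<Rightarrow> 'b::euclidean_space"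
  assumes "linear L" "bilinear B"
  shows "((\<lambda>x. c + L x + B x x) has_derivative (\<lambda>v. L v + (B x v + B v x))) (at x)"
proof -
  have "(L has_derivative L) (at x)"
    using assms(1) by (simp add: bounded_linear_imp_has_derivative linear_conv_bounded_linear)
  from has_derivative_add[OF has_derivative_add[OF has_derivative_const this]
      bilinear_diagonal_has_derivative[OF assms(2)]]
  show ?thesis by simp
qed

text \<open>A directional derivative of a quadratic map is affine, hence again of the form
  \<open>c + L x + B x x\<close>: this class is stable under differentiation.\<close>

lemma Ck_on_quadratic:
  fixes L :: "'a::euclidean_space \<Rightarrow> 'b::euclidean_space"
  assumes "linear L" "bilinear B"
  shows "Ck_on n W (\<lambda>x. c + L x + B x x)"
  using assms
proof (induction n arbitrary: c L B)
  case 0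
  have "continuous_on W (\<lambda>x. c + L x + B x x)"
    by (rule has_derivative_continuous_on[OF
        has_derivative_at_withinI[OF quadratic_has_derivative[OF 0]]])
  then show ?case by simp
next
  case (Suc n)
  note D = quadratic_has_derivative[OF Suc.prems]
  have "Ck_on n W (\<lambda>x. frechet_derivative (\<lambda>x. c + L x + B x x) (at x) v)" for v
  proof -
    have "linear (\<lambda>x. B x v + B v x)"
      using Suc.prems(2) unfolding bilinear_def by (intro linear_compose_add) auto
    moreover have "bilinear (\<lambda>(x::'a) (y::'a). 0::'b)"
      by (simp add: bilinear_def linear_iff)
    ultimately have "Ck_on n W (\<lambda>x. L v + (B x v + B v x) + 0)"
      by (rule Suc.IH)
    moreover have "frechet_derivative (\<lambda>x. c + L x + B x x) (at x) v
        = L v + (B x v + B v x) + 0" for x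
      unfolding frechet_derivative_at[OF D, symmetric] by simp
    ultimately show ?thesis by presburger
  qed
  moreover have "(\<lambda>x. c + L x + B x x) differentiable (at x)" for x
    using D unfolding differentiable_def by blast
  ultimately show ?case
    unfolding Ck_on.simps(2) by blast
qed

text \<open>The difference quotients lie in the subspace, which is closed.\<close>

lemma vector_derivative_in_subspace:
  fixes \<gamma> :: "real \<Rightarrow> 'a::euclidean_space"
  assumes V: "subspace V" and "e > 0" and \<gamma>: "\<And>t. \<bar>t\<bar> < e \<Longrightarrow> \<gamma> t \<in> V"
    and deriv: "(\<gamma> has_vector_derivative v) (at 0)"
  shows "v \<in> V"
proof -
  have "((\<lambda>t. norm (\<gamma> t - \<gamma> 0 - t *\<^sub>R v) / norm t) \<longlongrightarrow> 0) (at 0)"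
    using deriv unfolding has_vector_derivative_def has_derivative_iff_norm by simp
  moreover have "\<forall>\<^sub>F t in at 0.
      norm (\<gamma> t - \<gamma> 0 - t *\<^sub>R v) / norm t = norm ((\<gamma> t - \<gamma> 0) /\<^sub>R t - v)"
    unfolding eventually_at_filter
  proof (intro always_eventually allI impI)
    fix t :: real assume "t \<noteq> 0"
    then have "(\<gamma> t - \<gamma> 0) /\<^sub>R t - v = (\<gamma> t - \<gamma> 0 - t *\<^sub>R v) /\<^sub>R t"
      by (simp add: scaleR_diff_right)
    then show "norm (\<gamma> t - \<gamma> 0 - t *\<^sub>R v) / norm t = norm ((\<gamma> t - \<gamma> 0) /\<^sub>R t - v)"
      by (simp add: divide_inverse)
  qed
  ultimately have "((\<lambda>t. norm ((\<gamma> t - \<gamma> 0) /\<^sub>R t - v)) \<longlongrightarrow> 0) (at 0)"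
    by (rule Lim_transform_eventually)
  then have lim: "((\<lambda>t. (\<gamma> t - \<gamma> 0) /\<^sub>R t) \<longlongrightarrow> v) (at 0)"
    by (simp add: tendsto_norm_zero_iff Lim_null[of _ v])
  have "\<forall>\<^sub>F t in at 0. (\<gamma> t - \<gamma> 0) /\<^sub>R t \<in> V"
    using \<open>e > 0\<close>
    by (auto simp: eventually_at intro!: exI[of _ e] subspace_scale[OF V] subspace_diff[OF V] \<gamma>)
  then show ?thesis
    using Lim_in_closed_set[OF closed_subspace[OF V] _ _ lim] by simp
qed

text \<open>The map \<open>x \<mapsto> x - B x x\<close> is inverted by \<open>y \<mapsto> y + B y y\<close>
  when \<open>B\<close> vanishes as soon as one argument is a value of \<open>B\<close>, because the
  shear then leaves \<open>B x x\<close> unchanged.  The offset \<open>c\<close> lets the same chart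
  straighten a manifold and, shifted, each leaf of its foliation, which is an affine and in
  general not a linear subspace in the chart of the manifold.\<close>

locale quadratic_shear =
  fixes B :: "'a::euclidean_space \<Rightarrow> 'a \<Rightarrow> 'a"
  assumes bilinear: "bilinear B"
    and nilpotent_left: "B (B x y) z = 0"
    and nilpotent_right: "B z (B x y) = 0"
begin

definition straighten :: "'a \<Rightarrow> 'a \<Rightarrow> 'a" where
  "straighten c x = x - B x x - c"

definition bend :: "'a \<Rightarrow> 'a \<Rightarrow> 'a" where
  "bend c y = (y + c) + B (y + c) (y + c)"

lemmas bilinear_simps =
  bilinear_ladd[OF bilinear] bilinear_radd[OF bilinear]
  bilinear_lsub[OF bilinear] bilinear_rsub[OF bilinear]
  nilpotent_left nilpotent_right

lemma bend_straighten [simp]: "bend c (straighten c x) = x"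
  by (simp add: bend_def straighten_def bilinear_simps)

lemma straighten_bend [simp]: "straighten c (bend c y) = y"
  by (simp add: bend_def straighten_def bilinear_simps)

lemma straighten_has_derivative:
  "(straighten c has_derivative (\<lambda>v. v - (B x v + B v x))) (at x)"
  unfolding straighten_def
  using has_derivative_diff[OF has_derivative_diff[OF has_derivative_ident
        bilinear_diagonal_has_derivative[OF bilinear]] has_derivative_const]
  by simp

lemma smooth_on_straighten: "smooth_on W (straighten c)"
proof -
  have "bilinear (\<lambda>x y. - B x y)"
    using bilinear unfolding bilinear_def by (auto intro: linear_compose_neg)
  from Ck_on_quadratic[OF linear_ident this, of _ W "- c"] show ?thesis
    unfolding smooth_on_def straighten_def[abs_def] by (simp add: algebra_simps)
qed

lemma bend_quadratic: "bend c = (\<lambda>y. (c + B c c) + (y + (B y c + B c y)) + B y y)"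
  by (simp add: fun_eq_iff bend_def bilinear_simps algebra_simps)

lemma bend_linear_part: "linear (\<lambda>y. y + (B y c + B c y))"
  using bilinear unfolding bilinear_def
  by (intro linear_compose_add) (auto simp: linear_ident)

lemma smooth_on_bend: "smooth_on W (bend c)"
  unfolding smooth_on_def bend_quadratic
  using Ck_on_quadratic[OF bend_linear_part bilinear] by blast

lemma bend_has_derivative:
  "(bend c has_derivative (\<lambda>v. v + (B (y + c) v + B v (y + c)))) (at y)"
  using quadratic_has_derivative[OF bend_linear_part bilinear, of "c + B c c" c y]
  unfolding bend_quadratic by (simp add: bilinear_simps algebra_simps)

lemma continuous_on_bend: "continuous_on T (bend c)"
  by (rule has_derivative_continuous_on[OF has_derivative_at_withinI[OF bend_has_derivative]])

lemma smooth_diffeo_straighten: "smooth_diffeo UNIV UNIV (straighten c)"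
proof -
  have "continuous_on UNIV (straighten c)"
    by (rule has_derivative_continuous_on[OF straighten_has_derivative])
  then have "homeomorphism UNIV UNIV (straighten c) (bend c)"
    by (intro homeomorphismI) (auto intro: continuous_on_bend)
  then show ?thesis
    unfolding smooth_diffeo_def using smooth_on_straighten smooth_on_bend by blast
qed

lemma straighten_image: "straighten c ` {x. straighten c x \<in> V} = V"
  by (auto intro!: image_eqI[of _ _ "bend c _"])

lemma straightened_submanifold:
  assumes "subspace V"
  shows "submanifold (dim V) {x. straighten c x \<in> V}"
  unfolding submanifold_def
proof (intro ballI exI conjI)
  show "smooth_diffeo UNIV UNIV (straighten c)" by (rule smooth_diffeo_straighten)
qed (use assms in \<open>auto simp: straighten_image\<close>)

text \<open>A curve in the manifold has a straightened image in \<open>V\<close>, whose velocity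
  then lies in \<open>V\<close> too; conversely a line in \<open>V\<close> is bent into a curve with
  the prescribed velocity.\<close>

lemma straightened_tangent_space:
  assumes V: "subspace V" and x: "straighten c x \<in> V"
  shows "tangent_space {x. straighten c x \<in> V} x = {v. v - (B x v + B v x) \<in> V}"
    (is "?T = ?R")
proof (intro equalityI subsetI)
  fix v assume "v \<in> ?T"
  then obtain \<gamma> e where \<gamma>: "e > 0" "\<gamma> 0 = x" "\<And>t. \<bar>t\<bar> < e \<Longrightarrow> straighten c (\<gamma> t) \<in> V"
    "(\<gamma> has_vector_derivative v) (at (0::real))"
    unfolding tangent_space_def by auto
  have "((straighten c \<circ> \<gamma>) has_vector_derivative (v - (B x v + B v x))) (at 0)"
    using vector_derivative_diff_chain_within[OF \<gamma>(4)
        has_derivative_at_withinI[OF straighten_has_derivative, of c]] \<gamma>(2) by simp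
  then have "v - (B x v + B v x) \<in> V"
    by (rule vector_derivative_in_subspace[OF V \<gamma>(1), rotated]) (simp add: \<gamma>(3))
  then show "v \<in> ?R" by simp
next
  fix v assume "v \<in> ?R"
  define w where "w = v - (B x v + B v x)"
  have w: "w \<in> V" using \<open>v \<in> ?R\<close> by (simp add: w_def)
  define \<gamma> where "\<gamma> t = bend c (straighten c x + t *\<^sub>R w)" for t :: real
  have line: "((\<lambda>t. straighten c x + t *\<^sub>R w) has_vector_derivative w) (at 0)"
    by (auto intro!: derivative_eq_intros)
  have "(\<gamma> has_vector_derivative
      w + (B (straighten c x + c) w + B w (straighten c x + c))) (at 0)"
    using vector_derivative_diff_chain_within[OF line
        has_derivative_at_withinI[OF bend_has_derivative, of c]]
    by (simp add: \<gamma>_def[abs_def] o_def)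
  moreover have "w + (B (straighten c x + c) w + B w (straighten c x + c)) = v"
    by (simp add: w_def straighten_def bilinear_simps)
  ultimately have "(\<gamma> has_vector_derivative v) (at 0)" by simp
  moreover have "straighten c (\<gamma> t) \<in> V" for t
    by (simp add: \<gamma>_def V subspace_add subspace_scale w x)
  moreover have "\<gamma> 0 = x" by (simp add: \<gamma>_def)
  ultimately show "v \<in> ?T"
    unfolding tangent_space_def by (auto intro!: exI[of _ \<gamma>] exI[of _ 1])
qed

text \<open>One chart serves all points.  Each leaf is the image of an affine subspace under
  \<open>bend c\<close>, hence path-connected and its own only component.\<close>

lemma straightened_foliation:
  assumes V: "subspace V" and V0: "subspace V0" "V0 \<subseteq> V"
  shows "foliation (dim V0) (dim V) {x. straighten c x \<in> V}
    ((\<lambda>d. {x. straighten c x - d \<in> V0}) ` V)"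
proof -
  define leaf where "leaf d = {x. straighten c x - d \<in> V0}" for d
  have leaf_bend: "leaf d = bend c ` ((\<lambda>y. d + y) ` V0)" for d
  proof -
    have "x \<in> bend c ` ((\<lambda>y. d + y) ` V0)" if "straighten c x - d \<in> V0" for x
      using that bend_straighten[of c x]
      by (intro image_eqI[of _ _ "straighten c x"] image_eqI[of _ _ "straighten c x - d"]) auto
    then show ?thesis by (auto simp: leaf_def)
  qed
  have connected: "path_connected (leaf d)" for d
    unfolding leaf_bend
    by (intro path_connected_continuous_image continuous_on_bend convex_imp_path_connected
        convex_translation subspace_imp_convex V0(1))
  have nonempty: "bend c d \<in> leaf d" for d
    by (simp add: leaf_def subspace_0[OF V0(1)])
  have "partition_on {x. straighten c x \<in> V} (leaf ` V)"
  proof (rule partition_onI)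
    show "\<Union> (leaf ` V) = {x. straighten c x \<in> V}"
    proof -
      have "straighten c x \<in> V" if "straighten c x - d \<in> V0" "d \<in> V" for x d
        using subspace_add[OF V, of "straighten c x - d" d] that V0(2) by auto
      then show ?thesis
        using subspace_0[OF V0(1)] by (force simp: leaf_def)
    qed
  next
    fix P Q assume "P \<in> leaf ` V" "Q \<in> leaf ` V" "P \<noteq> Q"
    then obtain d d' where d: "P = leaf d" "Q = leaf d'" by blast
    have "leaf d = leaf d'" if "x \<in> leaf d" "x \<in> leaf d'" for x
    proof -
      have "d - d' \<in> V0" "d' - d \<in> V0"
        using that subspace_diff[OF V0(1), of "straighten c x - d'" "straighten c x - d"]
          subspace_diff[OF V0(1), of "straighten c x - d" "straighten c x - d'"]
        by (auto simp: leaf_def)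
      then have "straighten c y - d \<in> V0 \<longleftrightarrow> straighten c y - d' \<in> V0" for y
        using subspace_add[OF V0(1), of "straighten c y - d" "d - d'"]
          subspace_add[OF V0(1), of "straighten c y - d'" "d' - d"] by auto
      then show ?thesis by (simp add: leaf_def)
    qed
    then show "disjnt P Q" using \<open>P \<noteq> Q\<close> d by (auto simp: disjnt_def)
  next
    show "{} \<notin> leaf ` V" using nonempty by blast
  qed
  moreover have "\<exists>d\<in>V. straighten c ` C = {y. y - d \<in> V0}"
    if "L \<in> leaf ` V" "C \<in> components L" for L C
  proof -
    from that(1) obtain d where d: "d \<in> V" "L = leaf d" by blast
    have "components L = {L}"
      using connected nonempty unfolding d(2)
      by (metis components_eq_sing_iff empty_iff path_connected_imp_connected)
    then have "straighten c ` C = {y. y - d \<in> V0}"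
      using that(2) straighten_image[of c "{y. y - d \<in> V0}"] by (simp add: d(2) leaf_def)
    then show ?thesis using d(1) by blast
  qed
  ultimately have "foliation (dim V0) (dim V) {x. straighten c x \<in> V} (leaf ` V)"
    unfolding foliation_def
  proof (intro conjI ballI exI)
    show "smooth_diffeo UNIV UNIV (straighten c)" by (rule smooth_diffeo_straighten)
    show "straighten c ` ({x. straighten c x \<in> V} \<inter> UNIV) = V \<inter> UNIV"
      by (simp add: straighten_image)
    show "path_connected L" if "L \<in> leaf ` V" for L
      using that connected by blast
  qed (use V V0 in simp_all)
  then show ?thesis by (simp add: leaf_def[abs_def])
qed

end

section \<open>The sheets of constant spin\<close>

text \<open>On the diagonal this is the orbital angular momentum \<open>(k \<times> p) / m\<close>
  together with the kinetic energy.  The static moment is taken from the first argument and the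
  momentum from the second, so that the map is bilinear.\<close>

fun orbital_part :: "real \<Rightarrow> sgal_dual \<Rightarrow> sgal_dual \<Rightarrow> sgal_dual" where
  "orbital_part m (j, k, p, E, f) (j', k', p', E', f') =
     ((1 / m) *\<^sub>R (k \<times> p'), 0, 0, (p \<bullet> p') / (2 * m), 0)"

lemma orbital_part_bilinear: "bilinear (orbital_part m)"
proof -
  have "linear (orbital_part m \<mu>)" for \<mu>
    by (cases \<mu>, rule linearI)
      (auto simp: cross_add_right cross_mult_right algebra_simps inner_add_right add_divide_distrib)
  moreover have "linear (\<lambda>\<mu>. orbital_part m \<mu> \<nu>)" for \<nu>
    by (cases \<nu>, rule linearI)
      (auto simp: cross_add_left cross_mult_left algebra_simps inner_add_left add_divide_distrib)
  ultimately show ?thesis unfolding bilinear_def by blast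
qed

interpretation orbital: quadratic_shear "orbital_part m" for m
proof
  show "bilinear (orbital_part m)" by (rule orbital_part_bilinear)
  show "orbital_part m (orbital_part m \<mu> \<nu>) \<xi> = 0" for \<mu> \<nu> \<xi>
    by (cases \<mu>; cases \<nu>; cases \<xi>) (simp add: zero_prod_def)
  show "orbital_part m \<xi> (orbital_part m \<mu> \<nu>) = 0" for \<mu> \<nu> \<xi>
    by (cases \<mu>; cases \<nu>; cases \<xi>) (simp add: zero_prod_def)
qed

text \<open>The images of a sheet and, up to translation, of its leaves under the straightening
  chart.\<close>

definition phase_space :: "sgal_dual set" where
  "phase_space = range (\<lambda>(k, p). (0, k, p, 0, 0))"

definition position_space :: "sgal_dual set" where
  "position_space = range (\<lambda>k. (0, k, 0, 0, 0))"

lemma mem_phase_space [simp]: "(j, k, p, E, f) \<in> phase_space \<longleftrightarrow> j = 0 \<and> E = 0 \<and> f = 0"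
  by (auto simp: phase_space_def)

lemma mem_position_space [simp]:
  "(j, k, p, E, f) \<in> position_space \<longleftrightarrow> j = 0 \<and> p = 0 \<and> E = 0 \<and> f = 0"
  by (auto simp: position_space_def)

lemma position_space_subset: "position_space \<subseteq> phase_space"
  by (auto simp: position_space_def)

lemma phase_space_linear: "linear (\<lambda>(k, p). (0, k, p, 0, 0) :: sgal_dual)"
  by (rule linearI) (auto simp: zero_prod_def)

lemma position_space_linear: "linear (\<lambda>k. (0, k, 0, 0, 0) :: sgal_dual)"
  by (rule linearI) (auto simp: zero_prod_def)

lemma subspace_phase_space: "subspace phase_space"
  unfolding phase_space_def by (rule linear_subspace_image[OF phase_space_linear subspace_UNIV])

lemma subspace_position_space: "subspace position_space"
  unfolding position_space_def
  by (rule linear_subspace_image[OF position_space_linear subspace_UNIV])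

lemma dim_phase_space: "dim phase_space = 6"
proof -
  have "dim phase_space = dim (UNIV :: ((real^3) \<times> (real^3)) set)"
    unfolding phase_space_def
    by (rule dim_image_eq[OF phase_space_linear]) (auto simp: inj_on_def)
  then show ?thesis by simp
qed

lemma dim_position_space: "dim position_space = 3"
proof -
  have "dim position_space = dim (UNIV :: (real^3) set)"
    unfolding position_space_def
    by (rule dim_image_eq[OF position_space_linear]) (auto simp: inj_on_def)
  then show ?thesis by simp
qed

lemma mem_spin_sheet:
  "(j, k, p, E, f) \<in> spin_sheet m U S0 \<longleftrightarrow>
     j = S0 + (1 / m) *\<^sub>R (k \<times> p) \<and> E = U + (p \<bullet> p) / (2 * m) \<and> f = m"
  by (auto simp: spin_sheet_def souriau_orbit_def spin_def internal_energy_def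
      power2_norm_eq_inner[of p] diff_eq_eq algebra_simps)

lemma spin_sheet_straightened:
  "spin_sheet m U S0 = {\<mu>. orbital.straighten m (S0, 0, 0, U, m) \<mu> \<in> phase_space}"
proof (rule set_eqI)
  fix \<mu> :: sgal_dual
  show "\<mu> \<in> spin_sheet m U S0 \<longleftrightarrow>
      \<mu> \<in> {\<mu>. orbital.straighten m (S0, 0, 0, U, m) \<mu> \<in> phase_space}"
    by (cases \<mu>) (auto simp: mem_spin_sheet orbital.straighten_def algebra_simps)
qed

text \<open>Putting the momentum into the offset makes the image of the leaf a linear subspace, as a
  slice chart requires.\<close>

lemma momentum_leaf_straightened:
  "{\<mu> \<in> spin_sheet m U S0. momentum \<mu> = p} =
     {\<mu>. orbital.straighten m (S0, 0, p, U, m) \<mu> \<in> position_space}"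
proof (rule set_eqI)
  fix \<mu> :: sgal_dual
  show "\<mu> \<in> {\<mu> \<in> spin_sheet m U S0. momentum \<mu> = p} \<longleftrightarrow>
      \<mu> \<in> {\<mu>. orbital.straighten m (S0, 0, p, U, m) \<mu> \<in> position_space}"
    by (cases \<mu>) (auto simp: mem_spin_sheet orbital.straighten_def algebra_simps)
qed

lemma momentum_foliation_straightened:
  "momentum_foliation (spin_sheet m U S0) =
     (\<lambda>d. {\<mu>. orbital.straighten m (S0, 0, 0, U, m) \<mu> - d \<in> position_space}) ` phase_space"
proof -
  have leaf: "{\<mu>. orbital.straighten m (S0, 0, 0, U, m) \<mu> - (0, k, p, 0, 0) \<in> position_space}
      = {\<mu> \<in> spin_sheet m U S0. momentum \<mu> = p}" for k p
  proof (rule set_eqI)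
    fix \<mu> :: sgal_dual
    show "\<mu> \<in> {\<mu>. orbital.straighten m (S0, 0, 0, U, m) \<mu> - (0, k, p, 0, 0) \<in> position_space}
        \<longleftrightarrow> \<mu> \<in> {\<mu> \<in> spin_sheet m U S0. momentum \<mu> = p}"
      by (cases \<mu>) (auto simp: mem_spin_sheet orbital.straighten_def algebra_simps)
  qed
  show ?thesis
    unfolding momentum_foliation_def phase_space_def image_image
    by (auto simp: leaf image_iff split_beta)
qed

text \<open>The derivative of the graph of \<open>S0 + (k \<times> p) / m\<close> and
  \<open>U + p \<bullet> p / (2 * m)\<close> in the direction \<open>(x, y)\<close>.\<close>

lemma tangent_space_spin_sheet:
  assumes "(j, k, p, E, f) \<in> spin_sheet m U S0"
  shows "tangent_space (spin_sheet m U S0) (j, k, p, E, f) =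
    range (\<lambda>(x, y). ((1 / m) *\<^sub>R (k \<times> y + x \<times> p), x, y, (p \<bullet> y) / m, 0))"
    (is "_ = ?R")
proof -
  have "v \<in> tangent_space (spin_sheet m U S0) (j, k, p, E, f) \<longleftrightarrow>
      v - (orbital_part m (j, k, p, E, f) v + orbital_part m v (j, k, p, E, f)) \<in> phase_space" for v
    using orbital.straightened_tangent_space[OF subspace_phase_space] assms
    unfolding spin_sheet_straightened by blast
  moreover have "v - (orbital_part m (j, k, p, E, f) v + orbital_part m v (j, k, p, E, f))
      \<in> phase_space \<longleftrightarrow> v \<in> ?R" for v
    by (cases v) (auto simp: image_iff scaleR_add_right inner_commute[of _ p])
  ultimately show ?thesis by blast
qed

lemma momentum_leaf_tangent:
  assumes "\<mu> \<in> spin_sheet m U S0" "momentum \<mu> = p"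
    and "u \<in> tangent_space {\<mu> \<in> spin_sheet m U S0. momentum \<mu> = p} \<mu>"
  shows "momentum u = 0"
proof -
  have "orbital.straighten m (S0, 0, p, U, m) \<mu> \<in> position_space"
    using assms(1,2) momentum_leaf_straightened[of m U S0 p] by blast
  then have "u - (orbital_part m \<mu> u + orbital_part m u \<mu>) \<in> position_space"
    using assms(3) orbital.straightened_tangent_space[OF subspace_position_space]
    unfolding momentum_leaf_straightened by blast
  then show ?thesis by (cases u; cases \<mu>) simp
qed

section \<open>The two symplectic forms\<close>

text \<open>The coadjoint action of boosts and translations depends on the angular momentum and the
  energy in no component.  For \<open>f = m \<noteq> 0\<close> the static moment and the momentum move
  independently, so these vectors exhaust the tangent space of a sheet.\<close>

lemma coad_boost_translation:
  "coad (0, b, c, 0, 0) (j, k, p, E, f) =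
     (b \<times> k + c \<times> p, f *\<^sub>R c, - (f *\<^sub>R b), - (p \<bullet> b), 0)"
proof (rule vector_eq_rdot[THEN iffD1], rule allI)
  fix Y :: sgal
  have T: "x \<bullet> (y \<times> z) = - ((y \<times> x) \<bullet> z)" for x y z :: "real^3"
    using cross_triple[of x y z] cross_skew[of x y] by (simp add: inner_commute)
  show "coad (0, b, c, 0, 0) (j, k, p, E, f) \<bullet> Y =
      (b \<times> k + c \<times> p, f *\<^sub>R c, - (f *\<^sub>R b), - (p \<bullet> b), 0) \<bullet> Y"
    unfolding coad_inner
    by (cases Y) (simp add: T inner_add_left inner_add_right inner_commute[of _ c]
        right_diff_distrib)
qed

lemma kks_spin_sheet:
  assumes "m \<noteq> 0" "(j, k, p, E, f) \<in> spin_sheet m U S0"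
  shows "kks (j, k, p, E, f)
      ((1 / m) *\<^sub>R (k \<times> y + x \<times> p), x, y, (p \<bullet> y) / m, 0)
      ((1 / m) *\<^sub>R (k \<times> y' + x' \<times> p), x', y', (p \<bullet> y') / m, 0) =
    (x \<bullet> y' - x' \<bullet> y) / m"
proof -
  have f: "f = m" using assms(2) by (simp add: mem_spin_sheet)
  \<comment> \<open>solving \<open>dk = m *\<^sub>R c\<close> and \<open>dp = - m *\<^sub>R b\<close> for the generator\<close>
  have tangent: "((1 / m) *\<^sub>R (k \<times> y + x \<times> p), x, y, (p \<bullet> y) / m, 0) =
      coad (0, - (1 / m) *\<^sub>R y, (1 / m) *\<^sub>R x, 0, 0) (j, k, p, E, f)" for x y
    using assms(1) unfolding coad_boost_translation
    by (simp add: f cross_mult_left cross_minus_left cross_skew[of y k] scaleR_add_right)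
  show ?thesis
    unfolding tangent kks_coad using assms(1)
    by (simp add: f field_simps inner_commute)
qed

lemma differential_momentum: "differential (\<lambda>\<nu>. momentum \<nu> $ i) \<mu> w = momentum w $ i"
proof -
  have momentum_eq: "momentum \<nu> = fst (snd (snd \<nu>))" for \<nu> by (cases \<nu>) simp
  have "linear (\<lambda>\<nu>. momentum \<nu> $ i)"
    unfolding momentum_eq by (rule linearI) simp_all
  then have "((\<lambda>\<nu>. momentum \<nu> $ i) has_derivative (\<lambda>w. momentum w $ i)) (at \<mu>)"
    by (simp add: bounded_linear_imp_has_derivative linear_conv_bounded_linear)
  then show ?thesis
    unfolding differential_def by (simp add: frechet_derivative_at[symmetric])
qed

text \<open>The factor \<open>1 / mass\<close> in the position contributes to the differential only
  along the direction of varying mass, which is excluded on an orbit.\<close>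

lemma differential_position:
  assumes "mass \<mu> \<noteq> 0" "mass w = 0"
  shows "differential (\<lambda>\<nu>. position \<nu> $ i) \<mu> w = static_moment w $ i / mass \<mu>"
proof -
  have eq: "static_moment \<nu> = fst (snd \<nu>)" "mass \<nu> = snd (snd (snd (snd \<nu>)))" for \<nu>
    by (cases \<nu>; simp)+
  have "linear (\<lambda>\<nu>. static_moment \<nu> $ i)" "linear mass"
    unfolding eq[abs_def] by (rule linearI; simp)+
  then have "((\<lambda>\<nu>. static_moment \<nu> $ i) has_derivative (\<lambda>w. static_moment w $ i)) (at \<mu>)"
    "(mass has_derivative mass) (at \<mu>)"
    by (simp_all add: bounded_linear_imp_has_derivative linear_conv_bounded_linear)
  from has_derivative_divide'[OF this assms(1)]
  have "((\<lambda>\<nu>. position \<nu> $ i) has_derivative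
      (\<lambda>w. (static_moment w $ i * mass \<mu> - static_moment \<mu> $ i * mass w)
        / (mass \<mu> * mass \<mu>))) (at \<mu>)"
    by (simp add: position_def)
  from frechet_derivative_at[OF this, symmetric] show ?thesis
    unfolding differential_def using assms by simp
qed

lemma canonical_form_eq:
  assumes "mass \<mu> \<noteq> 0" "mass u = 0" "mass v = 0"
  shows "canonical_form \<mu> u v =
    (static_moment u \<bullet> momentum v - static_moment v \<bullet> momentum u) / mass \<mu>"
proof -
  have "canonical_form \<mu> u v = (\<Sum>i\<in>UNIV.
      (static_moment u $ i * momentum v $ i - static_moment v $ i * momentum u $ i) / mass \<mu>)"
    unfolding canonical_form_def wedge_def differential_momentum
      differential_position[OF assms(1,2)] differential_position[OF assms(1,3)]
    by (simp add: diff_divide_distrib)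
  then show ?thesis
    by (simp add: inner_vec_def sum_subtractf flip: sum_divide_distrib)
qed

lemma kks_eq_canonical_form:
  assumes "m > 0" "\<mu> \<in> spin_sheet m U S0"
    and "u \<in> tangent_space (spin_sheet m U S0) \<mu>" "v \<in> tangent_space (spin_sheet m U S0) \<mu>"
  shows "kks \<mu> u v = canonical_form \<mu> u v"
proof -
  obtain j k p E f where \<mu>: "\<mu> = (j, k, p, E, f)" by (cases \<mu>)
  note sheet = assms(2)[unfolded \<mu>]
  have "f = m" using sheet by (simp add: mem_spin_sheet)
  then show ?thesis
    using assms kks_spin_sheet[OF _ sheet] unfolding \<mu> tangent_space_spin_sheet[OF sheet]
    by (auto simp: canonical_form_eq)
qed

lemma kks_linear_symplectic:
  assumes "m > 0" "\<mu> \<in> spin_sheet m U S0"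
  shows "linear_symplectic_on (tangent_space (spin_sheet m U S0) \<mu>) (kks \<mu>)"
proof -
  obtain j k p E f where \<mu>: "\<mu> = (j, k, p, E, f)" by (cases \<mu>)
  note sheet = assms(2)[unfolded \<mu>]
  define t where "t = (\<lambda>(x, y). ((1 / m) *\<^sub>R (k \<times> y + x \<times> p), x, y, (p \<bullet> y) / m, 0) :: sgal)"
  have T: "tangent_space (spin_sheet m U S0) \<mu> = range t"
    unfolding \<mu> t_def by (rule tangent_space_spin_sheet[OF sheet])
  have \<omega>: "kks \<mu> (t (x, y)) (t (x', y')) = (x \<bullet> y' - x' \<bullet> y) / m" for x y x' y'
    unfolding \<mu> t_def using kks_spin_sheet[OF _ sheet] assms(1) by simp
  have t: "linear t"
    by (rule linearI)
      (auto simp: t_def cross_add_left cross_add_right cross_mult_left cross_mult_right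
        inner_add_right algebra_simps add_divide_distrib)
  have lin: "a *\<^sub>R t (x, y) + b *\<^sub>R t (x', y') = t (a *\<^sub>R x + b *\<^sub>R x', a *\<^sub>R y + b *\<^sub>R y')"
    for a b x y x' y'
    by (simp add: linear_add[OF t, symmetric] linear_scale[OF t, symmetric])
  \<comment> \<open>For \<open>u = (x, y)\<close>, the test vectors \<open>(0, x)\<close> and \<open>(y, 0)\<close> give
    \<open>x \<bullet> x\<close> and \<open>- (y \<bullet> y)\<close>, up to the factor \<open>1 / m\<close>.\<close>
  have nondegenerate: "t u = 0" if zero: "\<forall>w. kks \<mu> (t u) (t w) = 0" for u
  proof (cases u)
    case (Pair x y)
    have "x \<bullet> x = 0" "y \<bullet> y = 0"
      using zero[THEN spec, of "(0, x)"] zero[THEN spec, of "(y, 0)"] assms(1)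
      unfolding Pair \<omega> by simp_all
    then have "u = 0" by (simp add: Pair zero_prod_def)
    then show ?thesis by (simp add: linear_0[OF t])
  qed
  have linear: "kks \<mu> (a *\<^sub>R t u + b *\<^sub>R t v) (t w) = a * kks \<mu> (t u) (t w) + b * kks \<mu> (t v) (t w)"
    for a b u v w
  proof (cases u, cases v, cases w)
    fix x y x' y' x'' y'' assume "u = (x, y)" "v = (x', y')" "w = (x'', y'')"
    then show ?thesis
      using assms(1) by (simp add: lin \<omega> inner_add_left inner_add_right field_simps)
  qed
  have antisym: "kks \<mu> (t v) (t u) = - kks \<mu> (t u) (t v)" for u v
    by (cases u; cases v) (simp add: \<omega> minus_divide_left)
  have "subspace (range t)"
    by (rule linear_subspace_image[OF t subspace_UNIV])
  then show ?thesis
    unfolding linear_symplectic_on_def T ball_simps(9)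
    by (intro conjI ballI allI impI linear antisym nondegenerate) auto
qed

section \<open>The foliation by momentum\<close>

lemma position_momentum_bij:
  assumes "m > 0"
  shows "bij_betw (\<lambda>\<mu>. (position \<mu>, momentum \<mu>)) (spin_sheet m U S0) UNIV"
proof -
  define g :: "real^3 \<Rightarrow> real^3 \<Rightarrow> sgal_dual" where
    "g q p = (S0 + q \<times> p, m *\<^sub>R q, p, U + (p \<bullet> p) / (2 * m), m)" for q p
  have "g (position \<mu>) (momentum \<mu>) = \<mu>" if "\<mu> \<in> spin_sheet m U S0" for \<mu>
    using that assms by (cases \<mu>) (simp add: g_def mem_spin_sheet position_def cross_mult_left)
  moreover have "g q p \<in> spin_sheet m U S0 \<and> position (g q p) = q \<and> momentum (g q p) = p" for q p
    using assms by (simp add: g_def mem_spin_sheet position_def cross_mult_left)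
  ultimately show ?thesis
    by (intro bij_betw_byWitness[where f' = "\<lambda>(q, p). g q p"]) auto
qed

lemma momentum_foliation_lagrangian:
  assumes "m > 0"
  shows "lagrangian_foliation (spin_sheet m U S0) kks (momentum_foliation (spin_sheet m U S0))"
proof -
  let ?M = "spin_sheet m U S0"
  have "foliation 3 (2 * 3) ?M (momentum_foliation ?M)"
    using orbital.straightened_foliation[OF subspace_phase_space subspace_position_space
        position_space_subset, of m "(S0, 0, 0, U, m)"]
    unfolding momentum_foliation_straightened unfolding spin_sheet_straightened
    by (simp add: dim_phase_space dim_position_space)
  moreover have "lagrangian_submanifold 3 ?M kks L" if "L \<in> momentum_foliation ?M" for L
  proof -
    from that obtain p where L: "L = {\<mu> \<in> ?M. momentum \<mu> = p}"
      unfolding momentum_foliation_def by blast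
    have "submanifold (2 * 3) ?M"
      using orbital.straightened_submanifold[OF subspace_phase_space, of m "(S0, 0, 0, U, m)"]
      unfolding spin_sheet_straightened by (simp add: dim_phase_space)
    moreover have "submanifold 3 L"
      using orbital.straightened_submanifold[OF subspace_position_space, of m "(S0, 0, p, U, m)"]
      unfolding L momentum_leaf_straightened by (simp add: dim_position_space)
    moreover have "kks \<mu> u v = 0"
      if "\<mu> \<in> L" "u \<in> tangent_space L \<mu>" "v \<in> tangent_space L \<mu>" for \<mu> u v
    proof -
      have "tangent_space L \<mu> \<subseteq> tangent_space ?M \<mu>"
        unfolding tangent_space_def L by blast
      then have "kks \<mu> u v = canonical_form \<mu> u v"
        using that assms by (intro kks_eq_canonical_form) (auto simp: L)
      moreover have "momentum u = 0" "momentum v = 0"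
        using that unfolding L by (auto intro: momentum_leaf_tangent)
      ultimately show ?thesis
        by (simp add: canonical_form_def wedge_def differential_momentum)
    qed
    ultimately show ?thesis
      unfolding lagrangian_submanifold_def using L by blast
  qed
  ultimately show ?thesis
    unfolding lagrangian_foliation_def using kks_linear_symplectic[OF assms] by blast
qed

theorem theorem34:
  fixes m U S2 :: real
  assumes "m > 0" and "S2 \<ge> 0"
  shows "(S2 = 0 \<longrightarrow>
      bij_betw (\<lambda>\<mu>. (position \<mu>, momentum \<mu>)) (souriau_orbit m U S2) UNIV \<and>
      (\<forall>\<mu>\<in>souriau_orbit m U S2. \<forall>u\<in>tangent_space (souriau_orbit m U S2) \<mu>.
         \<forall>v\<in>tangent_space (souriau_orbit m U S2) \<mu>. kks \<mu> u v = canonical_form \<mu> u v) \<and>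
      lagrangian_foliation (souriau_orbit m U S2) kks (momentum_foliation (souriau_orbit m U S2)))
    \<and> (\<forall>S0. (norm S0)\<^sup>2 = S2 \<longrightarrow>
      bij_betw (\<lambda>\<mu>. (position \<mu>, momentum \<mu>)) (spin_sheet m U S0) UNIV \<and>
      (\<forall>\<mu>\<in>spin_sheet m U S0. \<forall>u\<in>tangent_space (spin_sheet m U S0) \<mu>.
         \<forall>v\<in>tangent_space (spin_sheet m U S0) \<mu>. kks \<mu> u v = canonical_form \<mu> u v) \<and>
      lagrangian_foliation (spin_sheet m U S0) kks (momentum_foliation (spin_sheet m U S0)))"
proof -
  note sheet = position_momentum_bij[OF assms(1)] kks_eq_canonical_form[OF assms(1)]
    momentum_foliation_lagrangian[OF assms(1)]
  have spinless: "souriau_orbit m U 0 = spin_sheet m U 0"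
    by (auto simp: spin_sheet_def souriau_orbit_def)
  show ?thesis
    using sheet spinless by simp
qed

end
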